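(* For every infinite compact topological space $Y$, the relation $\omega^{*}\rightarrow(Y)^{1}_{2}$ fails.
   Context: $\omega$ is the countably infinite discrete space, $\beta(\omega)$ its Stone-Čech compactification, and $\omega^{*}=\beta(\omega)\setminus\omega$ with the subspace topology. For topological spaces $X,Y$, the relation $X\rightarrow(Y)^{1}_{2}$ means: whenever $X=P_0\cup P_1$, there are $i\in\{0,1\}$ and $Y'\subseteq P_i$ such that $Y'$ (with the subspace topology from $X$) is homeomorphic to $Y$. *)

theory Defs
  imports "HOL-Analysis.Analysis"
begin

text \<open>Cech's construction: a space \<open>X\<close> is mapped into the cube \<open>[0,1]\<^bsup>C(X,[0,1])\<^esup>\<close> by evaluation,
  and \<open>\<beta>(X)\<close> is the closure of the image. Extensionality makes each continuous map on the carrier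
  of \<open>X\<close> occur exactly once as a coordinate.\<close>

definition unit_maps :: "'a topology \<Rightarrow> ('a \<Rightarrow> real) set" where
  "unit_maps X =
     {f. continuous_map X (top_of_set {0..1::real}) f \<and> f \<in> extensional (topspace X)}"

definition stone_cech_map :: "'a topology \<Rightarrow> 'a \<Rightarrow> (('a \<Rightarrow> real) \<Rightarrow> real)" where
  "stone_cech_map X x = (\<lambda>f\<in>unit_maps X. f x)"

definition stone_cech :: "'a topology \<Rightarrow> (('a \<Rightarrow> real) \<Rightarrow> real) topology" where
  "stone_cech X =
     (let cube = product_topology (\<lambda>_. top_of_set {0..1::real}) (unit_maps X)
      in subtopology cube (cube closure_of (stone_cech_map X ` topspace X)))"

definition stone_cech_remainder :: "'a topology \<Rightarrow> (('a \<Rightarrow> real) \<Rightarrow> real) topology" where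
  "stone_cech_remainder X =
     subtopology (stone_cech X) (topspace (stone_cech X) - stone_cech_map X ` topspace X)"

definition omega_star :: "((nat \<Rightarrow> real) \<Rightarrow> real) topology" where
  "omega_star = stone_cech_remainder (discrete_topology (UNIV :: nat set))"

text \<open>The partition relation \<open>X \<rightarrow> (Y)\<^sup>1\<^sub>2\<close>; the two pieces need not be disjoint.\<close>

definition arrows_1_2 :: "'a topology \<Rightarrow> 'b topology \<Rightarrow> bool" where
  "arrows_1_2 X Y \<longleftrightarrow>
     (\<forall>P :: nat \<Rightarrow> 'a set. topspace X = P 0 \<union> P 1 \<longrightarrow>
        (\<exists>i\<in>{0, 1}. \<exists>Y'. Y' \<subseteq> P i \<and> subtopology X Y' homeomorphic_space Y))"

end

theory Submission
  imports Defs
begin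

text \<open>A copy of \<open>Y\<close> in \<open>\<omega>\<^sup>*\<close> is an infinite closed subset \<open>K\<close> of \<open>\<beta>(\<omega>)\<close>, and such a \<open>K\<close> contains a
  sequence \<open>d\<close> whose terms lie in the closures of pairwise disjoint subsets of \<open>\<omega>\<close>. The continuous
  extension of \<open>d\<close> to \<open>\<beta>(\<omega>)\<close> is injective with image inside \<open>K\<close>, so \<open>K\<close> contains a set of
  cardinality \<open>\<kappa> = |\<beta>(\<omega>)|\<close> determined by \<open>d\<close>. The number of sequences in \<open>\<beta>(\<omega>)\<close> is also at most
  \<open>\<kappa>\<close>: the power \<open>\<beta>(\<omega>)\<^bsup>\<omega>\<^esup>\<close> is compact with a countable dense set, hence a continuous image of
  \<open>\<beta>(\<omega>)\<close>. A Bernstein construction of length \<open>\<kappa>\<close> now splits \<open>\<omega>\<^sup>*\<close> so that both pieces meet every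
  such image, and neither piece can contain \<open>K\<close>.\<close>

unbundle cardinal_syntax

section \<open>Bernstein sets by transfinite recursion\<close>

text \<open>Along a well-order of \<open>I\<close> of type \<open>|I|\<close>, stage
  \<open>i\<close> picks two fresh points of \<open>A i\<close>, one for \<open>B\<close> and one to
  stay outside. Fewer than \<open>|I|\<close> stages precede it, so, \<open>A i\<close> being
  infinite, fewer than \<open>|A i|\<close> points are used up.\<close>

lemma Bernstein_set_exists:
  fixes A :: "'i \<Rightarrow> 'a set"
  assumes inf: "\<And>i. i \<in> I \<Longrightarrow> infinite (A i)"
    and le: "\<And>i. i \<in> I \<Longrightarrow> |I| \<le>o |A i|"
  shows "\<exists>B. \<forall>i\<in>I. A i \<inter> B \<noteq> {} \<and> A i - B \<noteq> {}"
proof -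
  define r where "r = |I|"
  have co: "Card_order r" and fld: "Field r = I"
    unfolding r_def by (rule card_of_Card_order, rule Field_card_of)
  then have wo: "Well_order r" by (simp add: card_order_on_well_order_on)
  have tot: "total_on I r" and wfr: "wf (r - Id)"
    using wo fld by (auto simp: well_order_on_def linear_order_on_def partial_order_on_def)
  \<comment> \<open>First components will form \<open>B\<close>; both components of every earlier
    pair are forbidden at stage \<open>i\<close>.\<close>
  define prev :: "('i \<Rightarrow> 'a \<times> 'a) \<Rightarrow> 'i \<Rightarrow> 'a set"
    where "prev = (\<lambda>f i. (fst \<circ> f) ` underS r i \<union> (snd \<circ> f) ` underS r i)"
  define P where "P = (\<lambda>f i z. i \<in> I \<longrightarrow> fst z \<in> A i - prev f i \<and> snd z \<in> A i - prev f i \<and> fst z \<noteq> snd z)"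
  have "\<exists>f. \<forall>i. P f i (f i)"
  proof (rule dependent_wf_choice[OF wfr])
    fix f g :: "'i \<Rightarrow> 'a \<times> 'a" and i z
    assume *: "\<And>j. (j, i) \<in> r - Id \<Longrightarrow> f j = g j"
    have "f j = g j" if "j \<in> underS r i" for j
      using * that by (auto simp: underS_def)
    then have "prev f i = prev g i" unfolding prev_def by (auto simp: image_iff)
    then show "P f i z = P g i z" by (simp add: P_def)
  next
    fix i and f :: "'i \<Rightarrow> 'a \<times> 'a"
    show "\<exists>z. P f i z"
    proof (cases "i \<in> I")
      case True
      have "|underS r i| <o r" using card_of_underS[OF co] True fld by simp
      then have u: "|underS r i| <o |A i|"
        using le[OF True] unfolding r_def by (rule ordLess_ordLeq_trans)
      have im: "|h ` underS r i| <o |A i|" for h :: "'i \<Rightarrow> 'a"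
        using card_of_image u by (rule ordLeq_ordLess_trans)
      have pv: "|prev f i| <o |A i|"
        unfolding prev_def by (rule card_of_Un_ordLess_infinite[OF inf[OF True] im im])
      \<comment> \<open>The finite set \<open>S\<close> allows the second point to be chosen
        different from the first.\<close>
      have more: "\<exists>x. x \<in> A i - (prev f i \<union> S)" if "finite S" for S
      proof (rule ccontr)
        assume "\<not> ?thesis"
        then have "A i \<subseteq> prev f i \<union> S" by blast
        moreover have "|prev f i \<union> S| <o |A i|"
          using card_of_Un_ordLess_infinite[OF inf[OF True] pv]
            that inf[OF True] ordLess_or_ordLeq[OF card_of_Well_order card_of_Well_order, of S "A i"]
            card_of_ordLeq_finite by blast
        ultimately show False
          using card_of_mono1 not_ordLess_ordLeq by blast
      qed
      obtain x where x: "x \<in> A i - prev f i" using more[of "{}"] by auto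
      obtain y where y: "y \<in> A i - prev f i" "y \<noteq> x" using more[of "{x}"] by auto
      show ?thesis using x y by (intro exI[of _ "(x, y)"]) (auto simp: P_def)
    qed (simp add: P_def)
  qed
  then obtain f where f: "\<And>i. P f i (f i)" by blast
  define B where "B = (fst \<circ> f) ` I"
  \<comment> \<open>If a second point equalled a first point of another stage, the later of the two
    stages would have reused a forbidden point; within one stage the two points differ.\<close>
  have "snd (f i) \<notin> B" if i: "i \<in> I" for i
  proof
    assume "snd (f i) \<in> B"
    then obtain j where j: "j \<in> I" "snd (f i) = fst (f j)" by (auto simp: B_def)
    consider "i = j" | "i \<in> underS r j" | "j \<in> underS r i"
      using tot i j by (auto simp: total_on_def underS_def)
    then show False
    proof cases
      case 1
      then show False using f[of i] i j by (simp add: P_def)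
    next
      case 2
      then have "snd (f i) \<in> prev f j" by (auto simp: prev_def)
      then show False using f[of j] j by (simp add: P_def)
    next
      case 3
      then have "fst (f j) \<in> prev f i" by (auto simp: prev_def)
      then show False using f[of i] i j by (simp add: P_def)
    qed
  qed
  moreover have "fst (f i) \<in> A i" "snd (f i) \<in> A i" if "i \<in> I" for i
    using f[of i] that by (simp_all add: P_def)
  ultimately show ?thesis by (intro exI[of _ B]) (fastforce simp: B_def)
qed

section \<open>Closures in cubes\<close>

abbreviation unit_cube :: "'i set \<Rightarrow> ('i \<Rightarrow> real) topology" where
  "unit_cube I \<equiv> product_topology (\<lambda>_. top_of_set {0..1}) I"

text \<open>Basic open sets of a cube restrict only finitely many coordinates, so one radius, a
  minimum of finitely many, serves them all.\<close>

lemma in_closure_of_unit_cube: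
  assumes "S \<subseteq> (\<Pi>\<^sub>E i\<in>I. {0..1})"
  shows "q \<in> unit_cube I closure_of S \<longleftrightarrow>
    q \<in> (\<Pi>\<^sub>E i\<in>I. {0..1}) \<and>
    (\<forall>F e. finite F \<longrightarrow> F \<subseteq> I \<longrightarrow> e > 0 \<longrightarrow> (\<exists>s\<in>S. \<forall>i\<in>F. \<bar>q i - s i\<bar> < e))"
    (is "?L \<longleftrightarrow> ?q \<and> ?R")
proof
  assume L: ?L
  then have q: ?q by (simp add: in_closure_of)
  moreover have ?R
  proof (intro allI impI)
    fix F and e :: real assume F: "finite F" "F \<subseteq> I" "e > 0"
    define T where "T = (\<Pi>\<^sub>E i\<in>I. if i \<in> F then {0..1} \<inter> ball (q i) e else {0..1})"
    have "finite {i \<in> I. (if i \<in> F then {0..1} \<inter> ball (q i) e else {0..1}) \<noteq> {0..1::real}}"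
      by (rule finite_subset[OF _ F(1)]) auto
    then have "openin (unit_cube I) T"
      unfolding T_def openin_PiE_gen by (auto simp: openin_open_Int)
    moreover have "q \<in> T" using q F by (auto simp: T_def PiE_iff)
    ultimately obtain s where s: "s \<in> S" "s \<in> T" using L by (auto simp: in_closure_of)
    have "\<bar>q i - s i\<bar> < e" if "i \<in> F" for i
    proof -
      have "s i \<in> {0..1} \<inter> ball (q i) e" using s(2) that F(2) by (auto simp: T_def PiE_iff split: if_splits)
      then show ?thesis by (simp add: dist_real_def)
    qed
    with s(1) show "\<exists>s\<in>S. \<forall>i\<in>F. \<bar>q i - s i\<bar> < e" by blast
  qed
  ultimately show "?q \<and> ?R" ..
next
  assume *: "?q \<and> ?R"
  show ?L
    unfolding in_closure_of
  proof (intro conjI allI impI)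
    show "q \<in> topspace (unit_cube I)" using * by simp
    fix T assume T: "q \<in> T \<and> openin (unit_cube I) T"
    then obtain V where V: "finite {i \<in> I. V i \<noteq> {0..1::real}}"
        "\<And>i. i \<in> I \<Longrightarrow> openin (top_of_set {0..1}) (V i)" "q \<in> Pi\<^sub>E I V" "Pi\<^sub>E I V \<subseteq> T"
      unfolding openin_product_topology_alt by force
    define F where "F = {i \<in> I. V i \<noteq> {0..1::real}}"
    have "\<exists>e>0. \<forall>y\<in>{0..1}. \<bar>q i - y\<bar> < e \<longrightarrow> y \<in> V i" if "i \<in> F" for i
    proof -
      have "q i \<in> V i" "openin (top_of_set {0..1}) (V i)" using V that by (auto simp: F_def PiE_iff)
      then obtain e where "e > 0" "\<And>y. \<lbrakk>y \<in> {0..1}; dist y (q i) < e\<rbrakk> \<Longrightarrow> y \<in> V i"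
        unfolding openin_euclidean_subtopology_iff by blast
      then show ?thesis
        by (intro exI[of _ e]) (simp add: dist_real_def abs_minus_commute)
    qed
    then obtain E where E: "\<And>i. i \<in> F \<Longrightarrow> E i > 0"
        "\<And>i y. \<lbrakk>i \<in> F; y \<in> {0..1}; \<bar>q i - y\<bar> < E i\<rbrakk> \<Longrightarrow> y \<in> V i" by metis
    \<comment> \<open>The extra \<open>1\<close> keeps the minimum defined when \<open>F\<close> is
      empty.\<close>
    define e where "e = Min (insert 1 (E ` F))"
    have finF: "finite F" using V by (simp add: F_def)
    have "e > 0" using finF E by (simp add: e_def)
    have eE: "e \<le> E i" if "i \<in> F" for i using finF that by (simp add: e_def)
    obtain s where s: "s \<in> S" "\<And>i. i \<in> F \<Longrightarrow> \<bar>q i - s i\<bar> < e"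
      using * finF \<open>e > 0\<close> unfolding F_def by (metis (no_types, lifting) mem_Collect_eq subsetI)
    have sc: "s \<in> (\<Pi>\<^sub>E i\<in>I. {0..1})" using s(1) assms by blast
    have "s i \<in> V i" if "i \<in> I" for i
    proof (cases "i \<in> F")
      case True
      then show ?thesis using E(2)[OF True, of "s i"] s(2)[OF True] eE[OF True] sc that by (auto simp: PiE_iff)
    next
      case False
      then show ?thesis using sc that by (auto simp: F_def PiE_iff)
    qed
    then have "s \<in> Pi\<^sub>E I V" using sc by (auto simp: PiE_iff)
    then show "\<exists>y. y \<in> S \<and> y \<in> T" using V(4) s(1) by blast
  qed
qed

section \<open>\<beta>(\<omega>) as a set of functionals on sequences in the unit interval\<close>

definition unit_seqs :: "(nat \<Rightarrow> real) set" where
  "unit_seqs = {f. \<forall>n. 0 \<le> f n \<and> f n \<le> 1}"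

definition beta_nat :: "((nat \<Rightarrow> real) \<Rightarrow> real) set" where
  "beta_nat = topspace (stone_cech (discrete_topology UNIV))"

definition point :: "nat \<Rightarrow> (nat \<Rightarrow> real) \<Rightarrow> real" where
  "point n = (\<lambda>f\<in>unit_seqs. f n)"

lemma point_apply [simp]: "f \<in> unit_seqs \<Longrightarrow> point n f = f n"
  by (simp add: point_def)

lemma indicator_in_unit_seqs [simp]: "indicator A \<in> unit_seqs"
  by (simp add: unit_seqs_def indicator_def)

lemma unit_maps_nat: "unit_maps (discrete_topology (UNIV :: nat set)) = unit_seqs"
  by (auto simp: unit_maps_def unit_seqs_def Pi_iff)

lemma stone_cech_map_nat: "stone_cech_map (discrete_topology (UNIV :: nat set)) = point"
  by (rule ext) (simp add: stone_cech_map_def point_def unit_maps_nat)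

lemma beta_nat_eq_closure: "beta_nat = unit_cube unit_seqs closure_of range point"
  unfolding beta_nat_def stone_cech_def Let_def unit_maps_nat stone_cech_map_nat
  by (simp only: topspace_discrete_topology topspace_subtopology_subset closure_of_subset_topspace)

lemma stone_cech_nat: "stone_cech (discrete_topology UNIV) = subtopology (unit_cube unit_seqs) beta_nat"
  unfolding beta_nat_eq_closure stone_cech_def Let_def unit_maps_nat stone_cech_map_nat by simp

lemma omega_star_eq:
  "omega_star = subtopology (unit_cube unit_seqs) (beta_nat - range point)"
proof -
  have "omega_star = subtopology (subtopology (unit_cube unit_seqs) beta_nat) (beta_nat - range point)"
    unfolding omega_star_def stone_cech_remainder_def stone_cech_map_nat beta_nat_def[symmetric]
    by (simp only: stone_cech_nat topspace_discrete_topology)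
  moreover have "beta_nat \<inter> (beta_nat - range point) = beta_nat - range point" by blast
  ultimately show ?thesis by (simp only: subtopology_subtopology)
qed

lemma point_in_cube: "range point \<subseteq> (\<Pi>\<^sub>E f\<in>unit_seqs. {0..1})"
proof (intro image_subsetI PiE_I)
  show "point n f \<in> {0..1}" if "f \<in> unit_seqs" for n f
    using that by (auto simp: unit_seqs_def)
qed (simp add: point_def)

lemma beta_nat_cube: "p \<in> beta_nat \<Longrightarrow> p \<in> (\<Pi>\<^sub>E f\<in>unit_seqs. {0..1})"
  unfolding beta_nat_eq_closure in_closure_of_unit_cube[OF point_in_cube] by blast

lemma beta_nat_range: "p \<in> beta_nat \<Longrightarrow> f \<in> unit_seqs \<Longrightarrow> 0 \<le> p f \<and> p f \<le> 1"
  using PiE_mem[OF beta_nat_cube, of p f] by simp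

text \<open>Density of \<omega> in the form used below: one natural number serves finitely many
  coordinates at once.\<close>

lemma beta_nat_approx:
  assumes p: "p \<in> beta_nat" and F: "finite F" "F \<subseteq> unit_seqs" "e > 0"
  obtains n where "\<And>f. f \<in> F \<Longrightarrow> \<bar>p f - f n\<bar> < e"
proof -
  obtain n where n: "\<forall>f\<in>F. \<bar>p f - point n f\<bar> < e"
    using p F unfolding beta_nat_eq_closure in_closure_of_unit_cube[OF point_in_cube] by blast
  have "\<bar>p f - f n\<bar> < e" if "f \<in> F" for f
    using n that F(2) by (metis point_apply subsetD)
  then show ?thesis by (rule that)
qed

lemma point_in_beta_nat: "point n \<in> beta_nat"
proof -
  have "range point \<subseteq> unit_cube unit_seqs closure_of range point"
    by (rule closure_of_subset) (use point_in_cube in simp)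
  then show ?thesis unfolding beta_nat_eq_closure by blast
qed

lemma infinite_beta_nat: "infinite beta_nat"
proof -
  have "inj point"
  proof (rule injI)
    fix m n :: nat assume eq: "point m = point n"
    show "m = n" using fun_cong[OF eq, of "indicator {m}"] by (simp add: indicator_def split: if_splits)
  qed
  then have "infinite (range point)" by (rule range_inj_infinite)
  then show ?thesis
    using point_in_beta_nat by (meson finite_subset image_subsetI)
qed

section \<open>Points as ultrafilters\<close>

text \<open>\<open>p (indicator A) = 1\<close> encodes that \<open>p\<close> lies in the closure of
  \<open>A\<close>. Adding \<open>indicator A\<close> to \<open>F\<close> with tolerance at most 1
  forces the approximating \<open>n\<close> into \<open>A\<close>.\<close>

lemma beta_nat_approx_on:
  assumes p: "p \<in> beta_nat" "p (indicator A) = 1" and F: "finite F" "F \<subseteq> unit_seqs" and "e > 0"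
  obtains n where "n \<in> A" "\<And>f. f \<in> F \<Longrightarrow> \<bar>p f - f n\<bar> < e"
proof -
  obtain n where n: "\<And>f. f \<in> insert (indicator A) F \<Longrightarrow> \<bar>p f - f n\<bar> < min 1 e"
    using beta_nat_approx[OF p(1), of "insert (indicator A) F" "min 1 e"] F \<open>e > 0\<close> by auto
  have "n \<in> A" using n[of "indicator A"] p(2) by (auto simp: indicator_def split: if_splits)
  moreover have "\<bar>p f - f n\<bar> < e" if "f \<in> F" for f using n[of f] that by simp
  ultimately show ?thesis by (rule that)
qed

lemma beta_nat_agree:
  assumes p: "p \<in> beta_nat" "p (indicator A) = 1" and fg: "f \<in> unit_seqs" "g \<in> unit_seqs"
    and eq: "\<And>n. n \<in> A \<Longrightarrow> f n = g n"
  shows "p f = p g"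
proof (rule ccontr)
  assume "p f \<noteq> p g"
  then obtain n where "n \<in> A" "\<And>h. h \<in> {f, g} \<Longrightarrow> \<bar>p h - h n\<bar> < \<bar>p f - p g\<bar> / 2"
    using beta_nat_approx_on[OF p, of "{f, g}" "\<bar>p f - p g\<bar> / 2"] fg by auto
  from this(2)[of f] this(2)[of g] eq[OF this(1)] show False by (simp add: abs_if split: if_splits)
qed

lemma beta_nat_constant_on:
  assumes p: "p \<in> beta_nat" "p (indicator A) = 1" and f: "f \<in> unit_seqs"
    and eq: "\<And>n. n \<in> A \<Longrightarrow> f n = c"
  shows "p f = c"
proof (rule ccontr)
  assume "p f \<noteq> c"
  then obtain n where "n \<in> A" "\<bar>p f - f n\<bar> < \<bar>p f - c\<bar>"
    using beta_nat_approx_on[OF p, of "{f}" "\<bar>p f - c\<bar>"] f by auto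
  then show False using eq by simp
qed

text \<open>At each \<open>n\<close> one of the two indicators is exactly 1, so approximation
  prevents both values from staying away from 1.\<close>

lemma beta_nat_indicator_cases:
  assumes "p \<in> beta_nat"
  shows "p (indicator A) = 1 \<or> p (indicator (- A)) = 1"
proof (rule ccontr)
  assume "\<not> ?thesis"
  then have "min \<bar>p (indicator A) - 1\<bar> \<bar>p (indicator (- A)) - 1\<bar> > 0" (is "?e > 0") by auto
  then obtain n where "\<And>f. f \<in> {indicator A, indicator (- A)} \<Longrightarrow> \<bar>p f - f n\<bar> < ?e"
    using beta_nat_approx[OF assms, of "{indicator A, indicator (- A)}" ?e] by auto
  from this[of "indicator A"] this[of "indicator (- A)"] show False
    by (cases "n \<in> A") auto
qed

lemma beta_nat_indicator_Int:
  assumes "p \<in> beta_nat" "p (indicator A) = 1" "p (indicator B) = 1"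
  shows "p (indicator (A \<inter> B)) = 1"
proof -
  have "p (indicator (A \<inter> B)) = p (indicator B)"
    by (rule beta_nat_agree[OF assms(1,2)]) (simp_all split: split_indicator)
  then show ?thesis using assms(3) by simp
qed

lemma beta_nat_indicator_UNIV:
  assumes "p \<in> beta_nat"
  shows "p (indicator UNIV) = 1"
proof (rule ccontr)
  assume "p (indicator UNIV) \<noteq> 1"
  then have "p (indicator {}) = 1" using beta_nat_indicator_cases[OF assms, of UNIV] by simp
  then show False by (rule beta_nat_approx_on[OF assms _ finite.emptyI empty_subsetI zero_less_one]) simp
qed

text \<open>Cut \<omega> where a coordinate \<open>f\<close> distinguishing the points crosses the
  midpoint of its two values: each point is excluded from the closure of the wrong half, hence lies
  in that of the other.\<close>

lemma beta_nat_separate: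
  assumes p: "p \<in> beta_nat" and q: "q \<in> beta_nat" and "p \<noteq> q"
  shows "\<exists>C. p (indicator C) = 1 \<and> q (indicator (- C)) = 1"
proof -
  have *: "\<exists>C. p (indicator C) = 1 \<and> q (indicator (- C)) = 1"
    if p: "p \<in> beta_nat" and q: "q \<in> beta_nat" and f: "f \<in> unit_seqs" and less: "p f < q f" for p q f
  proof -
    define c where "c = (p f + q f) / 2"
    define C where "C = {n. f n < c}"
    have "p (indicator (- C)) \<noteq> 1"
    proof
      assume "p (indicator (- C)) = 1"
      then obtain n where "n \<in> - C" "\<bar>p f - f n\<bar> < c - p f"
        using beta_nat_approx_on[OF p, of "- C" "{f}" "c - p f"] f less by (auto simp: c_def)
      then show False by (auto simp: C_def)
    qed
    moreover have "q (indicator C) \<noteq> 1"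
    proof
      assume "q (indicator C) = 1"
      then obtain n where "n \<in> C" "\<bar>q f - f n\<bar> < q f - c"
        using beta_nat_approx_on[OF q, of C "{f}" "q f - c"] f less by (auto simp: c_def)
      then show False by (auto simp: C_def)
    qed
    ultimately show ?thesis using beta_nat_indicator_cases p q by blast
  qed
  obtain f where f: "f \<in> unit_seqs" "p f \<noteq> q f"
    using PiE_ext[OF beta_nat_cube[OF p] beta_nat_cube[OF q]] \<open>p \<noteq> q\<close> by blast
  then consider "p f < q f" | "q f < p f" by linarith
  then show ?thesis
  proof cases
    case 1
    then show ?thesis using *[OF p q f(1)] by blast
  next
    case 2
    then obtain C where "q (indicator C) = 1" "p (indicator (- C)) = 1" using *[OF q p f(1)] by blast
    then show ?thesis by (intro exI[of _ "- C"]) simp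
  qed
qed

section \<open>Separated sequences in infinite sets\<close>

text \<open>Two points of \<open>K\<close> in the closure of \<open>B\<close> split \<open>B\<close>
  into two halves. A half whose closure still holds infinitely many points of \<open>K\<close> is
  kept; the other is split off as \<open>A n\<close> with its point \<open>d n\<close>. Later pieces
  lie in the kept half, whence disjointness.\<close>

lemma separated_sequence_exists:
  assumes K: "K \<subseteq> beta_nat" "infinite K"
  obtains d A where "\<And>n. d n \<in> K" "disjoint_family A" "\<And>n::nat. d n (indicator (A n)) = 1"
proof -
  define Q where "Q = (\<lambda>B. infinite {p \<in> K. p (indicator B) = 1})"
  define R where "R = (\<lambda>B B' A x. B' \<subseteq> B \<and> A \<subseteq> B \<and> A \<inter> B' = {} \<and> x \<in> K \<and> x (indicator A) = (1::real))"
  have "\<exists>B. \<forall>n. Q (B n) \<and> (\<exists>A x. R (B n) (B (Suc n)) A x)"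
  proof (rule dependent_nat_choice)
    have "{p \<in> K. p (indicator UNIV) = 1} = K" using K(1) beta_nat_indicator_UNIV by blast
    then have "Q UNIV" using K(2) by (simp add: Q_def)
    then show "\<exists>B. Q B" ..
  next
    fix B and n :: nat assume "Q B"
    then have inf: "infinite {p \<in> K. p (indicator B) = 1}" by (simp add: Q_def)
    then obtain p where p: "p \<in> K" "p (indicator B) = 1" using not_finite_existsD by blast
    obtain q where q: "q \<in> K" "q (indicator B) = 1" "q \<noteq> p"
      using inf finite_subset[of "{p \<in> K. p (indicator B) = 1}" "{p}"] by blast
    obtain C where C: "p (indicator C) = 1" "q (indicator (- C)) = 1"
      using beta_nat_separate[of p q] p q K(1) by blast
    have pC: "p (indicator (B \<inter> C)) = 1" and qC: "q (indicator (B \<inter> - C)) = 1"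
      using beta_nat_indicator_Int p q C K(1) by blast+
    have "{p \<in> K. p (indicator B) = 1} \<subseteq>
        {p \<in> K. p (indicator (B \<inter> C)) = 1} \<union> {p \<in> K. p (indicator (B \<inter> - C)) = 1}"
      using beta_nat_indicator_cases beta_nat_indicator_Int K(1) by blast
    then have "Q (B \<inter> C) \<or> Q (B \<inter> - C)"
      unfolding Q_def using inf finite_subset by (metis (no_types, lifting) finite_UnI)
    then show "\<exists>B'. Q B' \<and> (\<exists>A x. R B B' A x)"
    proof
      assume "Q (B \<inter> C)"
      moreover have "R B (B \<inter> C) (B \<inter> - C) q" using q qC by (auto simp: R_def)
      ultimately show ?thesis by blast
    next
      assume "Q (B \<inter> - C)"
      moreover have "R B (B \<inter> - C) (B \<inter> C) p" using p pC by (auto simp: R_def)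
      ultimately show ?thesis by blast
    qed
  qed
  then obtain B where "\<And>n. \<exists>A x. R (B n) (B (Suc n)) A x" by blast
  then obtain A d where R: "\<And>n. R (B n) (B (Suc n)) (A n) (d n)" by metis
  have anti: "B n \<subseteq> B m" if "m \<le> n" for m n
    using lift_Suc_antimono_le[of B, OF _ that] R unfolding R_def by blast
  have disj: "A m \<inter> A n = {}" if "m < n" for m n
  proof -
    have "A n \<subseteq> B n" "A m \<inter> B (Suc m) = {}" using R unfolding R_def by blast+
    moreover have "B n \<subseteq> B (Suc m)" by (rule anti) (use that in simp)
    ultimately show ?thesis by blast
  qed
  have "disjoint_family A"
    unfolding disjoint_family_on_def
  proof (intro ballI impI)
    fix m n :: nat assume "m \<noteq> n"
    then show "A m \<inter> A n = {}" using disj[of m n] disj[of n m] by (cases "m < n") auto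
  qed
  with R show ?thesis by (intro that[of d A]) (auto simp: R_def)
qed

section \<open>Extending sequences to \<beta>(\<omega>)\<close>

text \<open>The continuous extension of \<open>n \<mapsto> d n\<close> to \<open>\<beta>(\<omega>)\<close>: a point \<open>p\<close> is its own evaluation functional
  on bounded sequences, so \<open>p (\<lambda>n. d n f)\<close> is the \<open>p\<close>-limit of \<open>d n f\<close>.\<close>

definition lift_seq :: "(nat \<Rightarrow> (nat \<Rightarrow> real) \<Rightarrow> real) \<Rightarrow> ((nat \<Rightarrow> real) \<Rightarrow> real) \<Rightarrow> (nat \<Rightarrow> real) \<Rightarrow> real" where
  "lift_seq d p = (\<lambda>f\<in>unit_seqs. p (\<lambda>n. d n f))"

lemma evaluate_seq_in_unit_seqs:
  assumes "\<And>n. d n \<in> beta_nat" "f \<in> unit_seqs"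
  shows "(\<lambda>n. d n f) \<in> unit_seqs"
  using beta_nat_range[OF assms] by (simp add: unit_seqs_def)

text \<open>An \<open>n\<close> approximating \<open>p\<close> on the sequences of values of
  \<open>d\<close> at finitely many \<open>f\<close> makes \<open>d n\<close> close to the lift.
  Hence a closed set containing \<open>range d\<close> contains the whole image.\<close>

lemma lift_seq_in_closure:
  assumes d: "\<And>n. d n \<in> beta_nat" and p: "p \<in> beta_nat"
  shows "lift_seq d p \<in> unit_cube unit_seqs closure_of range d"
proof -
  have sub: "range d \<subseteq> (\<Pi>\<^sub>E f\<in>unit_seqs. {0..1})" using beta_nat_cube[OF d] by blast
  show ?thesis
    unfolding in_closure_of_unit_cube[OF sub]
  proof (intro conjI allI impI)
    show "lift_seq d p \<in> (\<Pi>\<^sub>E f\<in>unit_seqs. {0..1})"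
      unfolding lift_seq_def
      using beta_nat_range[OF p evaluate_seq_in_unit_seqs[of d, OF d]] by (simp add: restrict_PiE_iff)
  next
    fix F and e :: real assume F: "finite F" "F \<subseteq> unit_seqs" "e > 0"
    have "(\<lambda>f n. d n f) ` F \<subseteq> unit_seqs"
      using evaluate_seq_in_unit_seqs[of d, OF d] F(2) by blast
    then obtain n where n: "\<And>h. h \<in> (\<lambda>f n. d n f) ` F \<Longrightarrow> \<bar>p h - h n\<bar> < e"
      using beta_nat_approx[OF p, of "(\<lambda>f n. d n f) ` F" e] F by blast
    have "\<bar>lift_seq d p f - d n f\<bar> < e" if "f \<in> F" for f
      using n[of "\<lambda>n. d n f"] that F(2) by (auto simp: lift_seq_def subset_iff)
    then show "\<exists>s\<in>range d. \<forall>f\<in>F. \<bar>lift_seq d p f - s f\<bar> < e" by blast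
  qed
qed

lemma inj_on_lift_seq:
  assumes d: "\<And>n. d n \<in> beta_nat" and A: "disjoint_family A" "\<And>n. d n (indicator (A n)) = 1"
  shows "inj_on (lift_seq d) beta_nat"
proof (rule inj_onI)
  fix p q assume p: "p \<in> beta_nat" and q: "q \<in> beta_nat" and eq: "lift_seq d p = lift_seq d q"
  show "p = q"
  proof (rule PiE_ext[OF beta_nat_cube[OF p] beta_nat_cube[OF q]])
    fix f assume f: "f \<in> unit_seqs"
    \<comment> \<open>\<open>h\<close> is constantly \<open>f n\<close> on \<open>A n\<close>, so the coordinate \<open>h\<close> of \<open>lift_seq d p\<close> recovers \<open>p f\<close>.\<close>
    define h where "h = (\<lambda>m. if \<exists>n. m \<in> A n then f (THE n. m \<in> A n) else 0)"
    have h: "h \<in> unit_seqs" using f by (auto simp: h_def unit_seqs_def)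
    have "h m = f n" if "m \<in> A n" for m n
    proof -
      have "(THE n. m \<in> A n) = n" using A(1) that by (intro the_equality) (auto simp: disjoint_family_on_def)
      then show ?thesis using that by (auto simp: h_def)
    qed
    then have "d n h = f n" for n by (rule beta_nat_constant_on[OF d A(2) h])
    then show "p f = q f" using fun_cong[OF eq, of h] h by (simp add: lift_seq_def)
  qed
qed

section \<open>Coding sequences in \<beta>(\<omega>) by single points\<close>

definition finite_seq :: "nat \<Rightarrow> nat \<Rightarrow> nat" where
  "finite_seq m k = (let xs = from_nat m in if k < length xs then xs ! k else 0)"

lemma finite_seq_dense:
  assumes "finite K"
  shows "\<exists>m. \<forall>k\<in>K. finite_seq m k = g k"
proof -
  obtain N where N: "\<And>k. k \<in> K \<Longrightarrow> k < N"
    using assms unfolding finite_nat_set_iff_bounded by blast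
  have "finite_seq (to_nat (map g [0..<N])) k = g k" if "k \<in> K" for k
    using N[OF that] by (simp add: finite_seq_def)
  then show ?thesis by blast
qed

text \<open>The continuous map \<open>\<beta>(\<omega>) \<rightarrow> \<beta>(\<omega>)\<^bsup>\<omega>\<^esup>\<close> extending the enumeration \<open>finite_seq\<close> of the eventually
  zero sequences of naturals, which are dense in the power.\<close>

definition beta_nat_seq :: "((nat \<Rightarrow> real) \<Rightarrow> real) \<Rightarrow> nat \<Rightarrow> (nat \<Rightarrow> real) \<Rightarrow> real" where
  "beta_nat_seq p k = lift_seq (\<lambda>m. point (finite_seq m k)) p"

lemma beta_nat_seq_apply: "f \<in> unit_seqs \<Longrightarrow> beta_nat_seq p k f = p (\<lambda>m. f (finite_seq m k))"
  by (simp add: beta_nat_seq_def lift_seq_def)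

lemma closedin_beta_nat: "closedin (unit_cube unit_seqs) beta_nat"
  unfolding beta_nat_eq_closure by (rule closedin_closure_of)

lemma compact_space_unit_cube: "compact_space (unit_cube I)"
  by (simp add: compact_space_product_topology compact_space_subtopology)

lemma Hausdorff_space_unit_cube: "Hausdorff_space (unit_cube I)"
  by (simp add: Hausdorff_space_product_topology Hausdorff_space_subtopology)

text \<open>The image of \<beta>(\<omega>) in the power is compact, hence closed, and it is also
  dense.\<close>

lemma beta_nat_seq_surj:
  assumes d: "\<And>k. d k \<in> beta_nat"
  shows "\<exists>p\<in>beta_nat. beta_nat_seq p = d"
proof -
  \<comment> \<open>The power is flattened into a single cube, so the closure criterion applies to
    it directly.\<close>
  define J where "J = unit_seqs \<times> (UNIV :: nat set)"
  define E where "E = (\<lambda>p. \<lambda>(f, k)\<in>J. beta_nat_seq p k f)"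
  define t where "t = (\<lambda>(f, k)\<in>J. d k f)"
  have reindex: "(\<lambda>m. f (finite_seq m k)) \<in> unit_seqs" if "f \<in> unit_seqs" for f k
    using that by (simp add: unit_seqs_def)
  have "continuous_map (unit_cube unit_seqs) (unit_cube J) E"
    unfolding continuous_map_componentwise
  proof (intro conjI ballI)
    show "E ` topspace (unit_cube unit_seqs) \<subseteq> extensional J" by (auto simp: E_def)
    \<comment> \<open>Each coordinate of \<open>E\<close> is a projection at a reindexed sequence,
      hence continuous.\<close>
    fix j assume "j \<in> J"
    then obtain f k where j: "j = (f, k)" "f \<in> unit_seqs" by (auto simp: J_def)
    have "(\<lambda>p. E p j) = (\<lambda>p. p (\<lambda>m. f (finite_seq m k)))"
      using j by (simp add: E_def J_def beta_nat_seq_apply)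
    then show "continuous_map (unit_cube unit_seqs) (top_of_set {0..1}) (\<lambda>p. E p j)"
      using continuous_map_product_projection[OF reindex[OF j(2)]] by metis
  qed
  then have "compactin (unit_cube J) (E ` beta_nat)"
    using image_compactin closedin_compact_space[OF compact_space_unit_cube closedin_beta_nat] by blast
  then have "closedin (unit_cube J) (E ` beta_nat)"
    by (rule compactin_imp_closedin[OF Hausdorff_space_unit_cube])
  then have cl: "unit_cube J closure_of (E ` beta_nat) = E ` beta_nat"
    by (rule closure_of_closedin)
  then have sub: "E ` beta_nat \<subseteq> (\<Pi>\<^sub>E j\<in>J. {0..1})"
    using closure_of_subset_topspace[of "unit_cube J" "E ` beta_nat"] by simp
  have "t \<in> unit_cube J closure_of (E ` beta_nat)"
    unfolding in_closure_of_unit_cube[OF sub]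
  proof (intro conjI allI impI)
    have "t j \<in> {0..1}" if "j \<in> J" for j
      using that beta_nat_range[OF d, of "fst j" "snd j"] by (simp add: t_def J_def mem_Times_iff split_beta)
    moreover have "t \<in> extensional J" by (simp add: t_def)
    ultimately show "t \<in> (\<Pi>\<^sub>E j\<in>J. {0..1})" by (simp only: PiE_iff) blast
    fix F and e :: real assume F: "finite F" "F \<subseteq> J" "e > 0"
    \<comment> \<open>Each \<open>d k\<close> is replaced by a natural \<open>g k\<close> close to
      it on the coordinates in \<open>F\<close>; then one \<open>m\<close> codes \<open>g\<close> on
      the finitely many \<open>k\<close> involved.\<close>
    have "\<exists>n. \<forall>f\<in>fst ` F. \<bar>d k f - f n\<bar> < e" for k
    proof -
      have "finite (fst ` F)" "fst ` F \<subseteq> unit_seqs" using F by (auto simp: J_def)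
      then show ?thesis by (rule beta_nat_approx[OF d _ _ \<open>e > 0\<close>, of _ k]) blast
    qed
    then obtain g where g: "\<And>k f. f \<in> fst ` F \<Longrightarrow> \<bar>d k f - f (g k)\<bar> < e" by metis
    obtain m where m: "\<And>k. k \<in> snd ` F \<Longrightarrow> finite_seq m k = g k"
      using finite_seq_dense[of "snd ` F" g] F(1) by blast
    have "\<bar>t j - E (point m) j\<bar> < e" if j: "j \<in> F" for j
    proof -
      obtain f k where fk: "j = (f, k)" by force
      then have f: "f \<in> unit_seqs" using F(2) j by (auto simp: J_def)
      have "E (point m) j = f (finite_seq m k)"
        using fk f reindex[OF f] by (simp add: E_def J_def beta_nat_seq_apply)
      also have "\<dots> = f (g k)" using m[of k] imageI[OF j, of snd] fk by simp
      finally have "E (point m) j = f (g k)" .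
      moreover have "t j = d k f" using fk f by (simp add: t_def J_def)
      ultimately show ?thesis using g[of f k] imageI[OF j, of fst] fk by simp
    qed
    then show "\<exists>s\<in>E ` beta_nat. \<forall>j\<in>F. \<bar>t j - s j\<bar> < e" using point_in_beta_nat by blast
  qed
  then obtain p where p: "p \<in> beta_nat" "t = E p" unfolding cl by blast
  have "beta_nat_seq p k = d k" for k
  proof (rule extensionalityI[of _ unit_seqs])
    show "beta_nat_seq p k \<in> extensional unit_seqs" by (simp add: beta_nat_seq_def lift_seq_def)
    show "d k \<in> extensional unit_seqs" using beta_nat_cube[OF d] by (auto simp: PiE_def)
    show "beta_nat_seq p k f = d k f" if "f \<in> unit_seqs" for f
      using fun_cong[OF p(2), of "(f, k)"] that by (simp add: t_def E_def J_def)
  qed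
  with p(1) show ?thesis by blast
qed

section \<open>The splitting of the remainder\<close>

theorem corollary2p3:
  fixes Y :: "'a topology"
  assumes "compact_space Y" and "infinite (topspace Y)"
  shows "\<not> arrows_1_2 omega_star Y"
proof
  assume arrows: "arrows_1_2 omega_star Y"
  \<comment> \<open>Every \<open>i\<close> codes a sequence; injectivity of its extension makes
    \<open>L i\<close> as large as \<open>beta_nat\<close>, hence at least as large as
    \<open>I\<close>.\<close>
  define I where "I = {i \<in> beta_nat. inj_on (lift_seq (beta_nat_seq i)) beta_nat}"
  define L where "L = (\<lambda>i. lift_seq (beta_nat_seq i) ` beta_nat)"
  have "infinite (L i)" if "i \<in> I" for i
    using that infinite_beta_nat finite_imageD unfolding L_def I_def by blast
  moreover have "|I| \<le>o |L i|" if "i \<in> I" for i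
  proof -
    have "|I| \<le>o |beta_nat|" by (rule card_of_mono1) (auto simp: I_def)
    moreover have "|beta_nat| \<le>o |L i|"
      using that unfolding L_def I_def by (intro card_of_ordLeqI) auto
    ultimately show ?thesis by (rule ordLeq_transitive)
  qed
  ultimately obtain B where B: "\<And>i. i \<in> I \<Longrightarrow> L i \<inter> B \<noteq> {} \<and> L i - B \<noteq> {}"
    using Bernstein_set_exists[of I L] by blast
  define P where "P = (\<lambda>k::nat. if k = 0 then topspace omega_star \<inter> B else topspace omega_star - B)"
  have "topspace omega_star = P 0 \<union> P 1" by (auto simp: P_def)
  then obtain k K where K: "K \<subseteq> P k" "subtopology omega_star K homeomorphic_space Y"
    using arrows unfolding arrows_1_2_def by blast
  have Ksub: "K \<subseteq> topspace omega_star" using K(1) by (auto simp: P_def split: if_splits)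
  have Kbeta: "K \<subseteq> beta_nat - range point" using Ksub by (auto simp: omega_star_eq)
  \<comment> \<open>Compactness of \<open>Y\<close> passes to \<open>K\<close>, which is therefore
    closed in the Hausdorff cube.\<close>
  have "compact_space (subtopology omega_star K)"
    using K(2) assms(1) homeomorphic_compact_space by blast
  then have "compactin omega_star K" using Ksub by (simp add: compactin_subspace)
  then have "compactin (unit_cube unit_seqs) K" by (simp add: omega_star_eq compactin_subtopology)
  then have "closedin (unit_cube unit_seqs) K"
    by (rule compactin_imp_closedin[OF Hausdorff_space_unit_cube])
  then have Kcl: "unit_cube unit_seqs closure_of K = K" by (rule closure_of_closedin)
  have "infinite K"
  proof -
    obtain h where "homeomorphic_map (subtopology omega_star K) Y h"
      using K(2) homeomorphic_space by blast
    then have "h ` K = topspace Y"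
      using homeomorphic_imp_surjective_map Ksub by (metis topspace_subtopology_subset)
    then show ?thesis using assms(2) by (metis finite_imageI)
  qed
  then obtain d A where d: "\<And>n. d n \<in> K" and A: "disjoint_family A" "\<And>n::nat. d n (indicator (A n)) = 1"
    using separated_sequence_exists[of K] Kbeta by blast
  have dbeta: "d n \<in> beta_nat" for n using d Kbeta by blast
  \<comment> \<open>The splitting was fixed before \<open>d\<close> was found, so it is essential
    that every sequence in \<open>beta_nat\<close> has a code.\<close>
  obtain i where i: "i \<in> beta_nat" "beta_nat_seq i = d" using beta_nat_seq_surj[of d, OF dbeta] by blast
  have iI: "i \<in> I" using i inj_on_lift_seq[of d A, OF dbeta A] by (simp add: I_def)
  have "L i \<subseteq> K"
  proof -
    have "range d \<subseteq> K" using d by blast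
    then have "unit_cube unit_seqs closure_of range d \<subseteq> K" using closure_of_mono Kcl by metis
    then show ?thesis using lift_seq_in_closure[of d, OF dbeta] i(2) by (auto simp: L_def)
  qed
  \<comment> \<open>\<open>L i\<close> meets both \<open>B\<close> and its complement, but
    \<open>K\<close>, which contains \<open>L i\<close>, lies on one side.\<close>
  then show False using B[OF iI] K(1) by (auto simp: P_def split: if_splits)
qed

end
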